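(* An algebra $(A,\rightarrow,\rightsquigarrow,1)$ of type $(2,2,0)$ is a commutative pseudo-BE algebra if and only if it satisfies, for all $x,y,z\in A$: $(Q_1)$ $(x\rightarrow 1)\rightsquigarrow y=(x\rightsquigarrow 1)\rightarrow y=y$; $(Q_2)$ $(x\rightarrow z)\rightsquigarrow(y\rightarrow z)=(z\rightarrow x)\rightsquigarrow(y\rightarrow x)$ and $(x\rightsquigarrow z)\rightarrow(y\rightsquigarrow z)=(z\rightsquigarrow x)\rightarrow(y\rightsquigarrow x)$; $(Q_3)$ $x\rightarrow(y\rightsquigarrow z)=y\rightsquigarrow(x\rightarrow z)$; $(Q_4)$ $x\rightarrow y=1$ iff $x\rightsquigarrow y=1$.
   Context: A pseudo-BE algebra is an algebra $(A,\rightarrow,\rightsquigarrow,1)$ of type $(2,2,0)$ such that for all $x,y,z\in A$: $x\rightarrow x=x\rightsquigarrow x=1$; $x\rightarrow 1=x\rightsquigarrow 1=1$; $1\rightarrow x=1\rightsquigarrow x=x$; $x\rightarrow(y\rightsquigarrow z)=y\rightsquigarrow(x\rightarrow z)$; $x\rightarrow y=1$ iff $x\rightsquigarrow y=1$. It is commutative if $(x\rightarrow y)\rightsquigarrow y=(y\rightarrow x)\rightsquigarrow x$ and $(x\rightsquigarrow y)\rightarrow y=(y\rightsquigarrow x)\rightarrow x$ for all $x,y\in A$. *)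

theory Defs
  imports Main
begin

text \<open>Algebras of type \<open>(2, 2, 0)\<close> are represented on an explicit carrier, so that the underlying
  set need not be a whole type; the operations are unconstrained outside the carrier.\<close>

locale algebra_2_2_0 =
  fixes A :: "'a set"
    and imp :: "'a \<Rightarrow> 'a \<Rightarrow> 'a" (infix "\<rightarrow>" 60)
    and limp :: "'a \<Rightarrow> 'a \<Rightarrow> 'a" (infix "\<leadsto>" 60)
    and one :: 'a ("\<one>")
  assumes imp_closed: "\<lbrakk>x \<in> A; y \<in> A\<rbrakk> \<Longrightarrow> x \<rightarrow> y \<in> A"
    and limp_closed: "\<lbrakk>x \<in> A; y \<in> A\<rbrakk> \<Longrightarrow> x \<leadsto> y \<in> A"
    and one_closed: "\<one> \<in> A"

locale pseudo_BE_algebra = algebra_2_2_0 +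
  assumes imp_self: "x \<in> A \<Longrightarrow> x \<rightarrow> x = \<one>"
    and limp_self: "x \<in> A \<Longrightarrow> x \<leadsto> x = \<one>"
    and imp_one: "x \<in> A \<Longrightarrow> x \<rightarrow> \<one> = \<one>"
    and limp_one: "x \<in> A \<Longrightarrow> x \<leadsto> \<one> = \<one>"
    and one_imp: "x \<in> A \<Longrightarrow> \<one> \<rightarrow> x = x"
    and one_limp: "x \<in> A \<Longrightarrow> \<one> \<leadsto> x = x"
    and exchange: "\<lbrakk>x \<in> A; y \<in> A; z \<in> A\<rbrakk> \<Longrightarrow> x \<rightarrow> (y \<leadsto> z) = y \<leadsto> (x \<rightarrow> z)"
    and imp_eq_one_iff: "\<lbrakk>x \<in> A; y \<in> A\<rbrakk> \<Longrightarrow> x \<rightarrow> y = \<one> \<longleftrightarrow> x \<leadsto> y = \<one>"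

locale commutative_pseudo_BE_algebra = pseudo_BE_algebra +
  assumes imp_limp_comm: "\<lbrakk>x \<in> A; y \<in> A\<rbrakk> \<Longrightarrow> (x \<rightarrow> y) \<leadsto> y = (y \<rightarrow> x) \<leadsto> x"
    and limp_imp_comm: "\<lbrakk>x \<in> A; y \<in> A\<rbrakk> \<Longrightarrow> (x \<leadsto> y) \<rightarrow> y = (y \<leadsto> x) \<rightarrow> x"

end

theory Submission
  imports Defs
begin

text \<open>By exchange, \<open>(Q\<^sub>2)\<close> says that the two sides of each commutativity law have the same image under
  every \<open>y \<rightarrow> _\<close> (respectively \<open>y \<leadsto> _\<close>). Conversely, by
  \<open>(Q\<^sub>1)\<close> every \<open>x \<leadsto> \<one>\<close> is a left unit of \<open>\<rightarrow>\<close>; in particular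
  \<open>(\<one> \<leadsto> \<one>) \<rightarrow> \<one> = \<one>\<close>, so \<open>(Q\<^sub>4)\<close> gives \<open>(\<one> \<leadsto> \<one>) \<leadsto> \<one> = \<one>\<close> and \<open>\<one>\<close> itself is
  a left unit of \<open>\<rightarrow>\<close>, and dually of \<open>\<leadsto>\<close>. Hence \<open>(Q\<^sub>2)\<close> at \<open>y = \<one>\<close> is commutativity.
  Commutativity of \<open>x\<close> and \<open>\<one>\<close> then gives \<open>x \<leadsto> x = \<one>\<close>, and since \<open>x \<rightarrow> \<one>\<close> is a left
  unit of \<open>\<leadsto>\<close>, \<open>x \<rightarrow> \<one> = (x \<rightarrow> \<one>) \<leadsto> (x \<rightarrow> \<one>) = \<one>\<close>.\<close>

text \<open>Exchange turns the left side into
  \<open>y \<rightarrow> ((x \<rightarrow> z) \<leadsto> z)\<close>, where commutativity swaps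
  \<open>x\<close> and \<open>z\<close>.\<close>

lemma (in commutative_pseudo_BE_algebra) imp_limp_imp_comm:
  assumes "x \<in> A" "y \<in> A" "z \<in> A"
  shows "(x \<rightarrow> z) \<leadsto> (y \<rightarrow> z) = (z \<rightarrow> x) \<leadsto> (y \<rightarrow> x)"
  using assms by (metis exchange imp_closed imp_limp_comm)

lemma (in commutative_pseudo_BE_algebra) limp_imp_limp_comm:
  assumes "x \<in> A" "y \<in> A" "z \<in> A"
  shows "(x \<leadsto> z) \<rightarrow> (y \<leadsto> z) = (z \<leadsto> x) \<rightarrow> (y \<leadsto> x)"
  using assms by (metis exchange limp_closed limp_imp_comm)

lemma (in algebra_2_2_0) commutative_pseudo_BE_algebraI:
  assumes Q1: "\<And>x y. \<lbrakk>x \<in> A; y \<in> A\<rbrakk> \<Longrightarrow> (x \<rightarrow> \<one>) \<leadsto> y = y"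
      "\<And>x y. \<lbrakk>x \<in> A; y \<in> A\<rbrakk> \<Longrightarrow> (x \<leadsto> \<one>) \<rightarrow> y = y"
    and Q2: "\<And>x y z. \<lbrakk>x \<in> A; y \<in> A; z \<in> A\<rbrakk> \<Longrightarrow> (x \<rightarrow> z) \<leadsto> (y \<rightarrow> z) = (z \<rightarrow> x) \<leadsto> (y \<rightarrow> x)"
      "\<And>x y z. \<lbrakk>x \<in> A; y \<in> A; z \<in> A\<rbrakk> \<Longrightarrow> (x \<leadsto> z) \<rightarrow> (y \<leadsto> z) = (z \<leadsto> x) \<rightarrow> (y \<leadsto> x)"
    and Q3: "\<And>x y z. \<lbrakk>x \<in> A; y \<in> A; z \<in> A\<rbrakk> \<Longrightarrow> x \<rightarrow> (y \<leadsto> z) = y \<leadsto> (x \<rightarrow> z)"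
    and Q4: "\<And>x y. \<lbrakk>x \<in> A; y \<in> A\<rbrakk> \<Longrightarrow> x \<rightarrow> y = \<one> \<longleftrightarrow> x \<leadsto> y = \<one>"
  shows "commutative_pseudo_BE_algebra A (\<rightarrow>) (\<leadsto>) \<one>"
proof -
  note closed = imp_closed limp_closed one_closed
  have one_imp: "\<one> \<rightarrow> y = y" if "y \<in> A" for y
    using Q1(2)[of "\<one> \<leadsto> \<one>" y] Q1(2)[of \<one> \<one>] Q4[of "\<one> \<leadsto> \<one>" \<one>] closed that by simp
  have one_limp: "\<one> \<leadsto> y = y" if "y \<in> A" for y
    using Q1(1)[of "\<one> \<rightarrow> \<one>" y] Q1(1)[of \<one> \<one>] Q4[of "\<one> \<rightarrow> \<one>" \<one>] closed that by simp
  have comm1: "(x \<rightarrow> y) \<leadsto> y = (y \<rightarrow> x) \<leadsto> x" if "x \<in> A" "y \<in> A" for x y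
    using Q2(1)[of x \<one> y] one_imp closed that by simp
  have comm2: "(x \<leadsto> y) \<rightarrow> y = (y \<leadsto> x) \<rightarrow> x" if "x \<in> A" "y \<in> A" for x y
    using Q2(2)[of x \<one> y] one_limp closed that by simp
  \<comment> \<open>In \<open>comm1\<close> at \<open>x\<close> and \<open>\<one>\<close>, one side
    is \<open>\<one>\<close> by \<open>Q1\<close>, the other is \<open>x \<leadsto> x\<close> by
    \<open>one_imp\<close>.\<close>
  have limp_self: "x \<leadsto> x = \<one>" if "x \<in> A" for x
    using comm1[of x \<one>] Q1(1)[of x \<one>] one_imp closed that by simp
  have imp_self: "x \<rightarrow> x = \<one>" if "x \<in> A" for x
    using limp_self Q4 that by simp
  have imp_one: "x \<rightarrow> \<one> = \<one>" if "x \<in> A" for x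
    using Q1(1)[of x "x \<rightarrow> \<one>"] limp_self[of "x \<rightarrow> \<one>"] closed that by simp
  have limp_one: "x \<leadsto> \<one> = \<one>" if "x \<in> A" for x
    using imp_one Q4 closed that by simp
  show ?thesis
    by unfold_locales
      (fact imp_self limp_self imp_one limp_one one_imp one_limp Q3 Q4 comm1 comm2)+
qed

theorem theorem4p14:
  fixes A :: "'a set"
    and imp :: "'a \<Rightarrow> 'a \<Rightarrow> 'a" (infix "\<rightarrow>" 60)
    and limp :: "'a \<Rightarrow> 'a \<Rightarrow> 'a" (infix "\<leadsto>" 60)
    and one :: 'a ("\<one>")
  assumes "algebra_2_2_0 A (\<rightarrow>) (\<leadsto>) \<one>"
  shows "commutative_pseudo_BE_algebra A (\<rightarrow>) (\<leadsto>) \<one> \<longleftrightarrow>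
    (\<forall>x\<in>A. \<forall>y\<in>A. \<forall>z\<in>A.
      ((x \<rightarrow> \<one>) \<leadsto> y = y \<and> (x \<leadsto> \<one>) \<rightarrow> y = y) \<and>
      ((x \<rightarrow> z) \<leadsto> (y \<rightarrow> z) = (z \<rightarrow> x) \<leadsto> (y \<rightarrow> x) \<and>
       (x \<leadsto> z) \<rightarrow> (y \<leadsto> z) = (z \<leadsto> x) \<rightarrow> (y \<leadsto> x)) \<and>
      x \<rightarrow> (y \<leadsto> z) = y \<leadsto> (x \<rightarrow> z) \<and>
      (x \<rightarrow> y = \<one> \<longleftrightarrow> x \<leadsto> y = \<one>))"
proof -
  interpret algebra_2_2_0 A imp limp one by fact
  show ?thesis (is "?L \<longleftrightarrow> ?R")
  proof
    assume ?L
    then interpret commutative_pseudo_BE_algebra A imp limp one .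
    \<comment> \<open>The unit identities hold since \<open>x \<rightarrow> \<one>\<close> and
      \<open>x \<leadsto> \<one>\<close> collapse to \<open>\<one>\<close>, a left unit of both
      operations.\<close>
    show ?R
      by (simp add: imp_one limp_one one_imp one_limp imp_limp_imp_comm limp_imp_limp_comm
          exchange imp_eq_one_iff)
  next
    assume R: ?R
    show ?L
      by (rule commutative_pseudo_BE_algebraI) (use R in blast)+
  qed
qed

end
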